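(* There is an absolute constant $C>0$ such that the following holds. Let $B_1$ be the unit disk in $\mathbb{R}^2$ and $B_{\frac12}$ the concentric disk of radius $\frac12$. If $f\in L\ln L(B_1)$, $u\geq 0$ in $B_1$ and $$\triangle u(x)=f(x),\quad x\in B_1,$$ where $u,f$ are smooth in $B_1$, then $$\max_{x\in B_{\frac 12}}u(x)\leq C\left(\min_{y\in B_{\frac 12}}u(y)+\|f\|^*_{L\ln L(B_1)}\right).$$
   Context: For a space $X$ of finite measure $|X|$, the Zygmund class $L\ln L(X)$ consists of all functions $f$ with $\int_X |f(x)|\max\{0,\ln|f(x)|\}\,dx<\infty$. The non-increasing rearrangement of $f$ is $f^*(t)=\inf\{s\ge 0: |\{x\in X:|f(x)|>s\}|\le t\}$, and $$\|f\|^*_{L\ln L(X)}=\int_0^\infty f^*(t)\ln\frac{|X|}{t}\,dt$$ (note $f^*(t)=0$ for $t\ge|X|$). $\triangle$ is the Euclidean Laplacian. The maximum and minimum over $B_{\frac12}$ are understood as supremum and infimum. *)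

theory Defs
  imports "HOL-Analysis.Analysis"
begin

text \<open>Derivatives are two-sided Frechet derivatives, so \<open>Ck_on\<close> and \<open>smooth_on\<close> are meant for open
  sets \<open>S\<close>; there they depend only on the values of the function on \<open>S\<close>. Likewise
  \<open>LlnL_norm\<close> is meant for sets \<open>X\<close> of finite measure.\<close>

fun Ck_on :: "nat \<Rightarrow> 'a::real_normed_vector set \<Rightarrow> ('a \<Rightarrow> real) \<Rightarrow> bool" where
  "Ck_on 0 S f \<longleftrightarrow> continuous_on S f"
| "Ck_on (Suc n) S f \<longleftrightarrow>
     (\<forall>x\<in>S. f differentiable (at x)) \<and>
     (\<forall>v. Ck_on n S (\<lambda>x. frechet_derivative f (at x) v))"

definition smooth_on :: "'a::real_normed_vector set \<Rightarrow> ('a \<Rightarrow> real) \<Rightarrow> bool" where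
  "smooth_on S f \<longleftrightarrow> (\<forall>n. Ck_on n S f)"

definition partial_derivative :: "'a::euclidean_space \<Rightarrow> ('a \<Rightarrow> real) \<Rightarrow> 'a \<Rightarrow> real" where
  "partial_derivative b f x = frechet_derivative f (at x) b"

definition laplacian :: "('a::euclidean_space \<Rightarrow> real) \<Rightarrow> 'a \<Rightarrow> real" where
  "laplacian u x = (\<Sum>b\<in>Basis. partial_derivative b (partial_derivative b u) x)"

text \<open>Integrals and rearrangements take values in \<open>[0, \<infinity>]\<close>. The convention \<open>ln 0 = 0\<close> is
  harmless in the next definition, since that logarithm is multiplied by 0.\<close>

definition LlnL :: "'a::euclidean_space set \<Rightarrow> ('a \<Rightarrow> real) set" where
  "LlnL X = {f. f \<in> borel_measurable (lebesgue_on X) \<and>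
     (\<integral>\<^sup>+x. ennreal (\<bar>f x\<bar> * max 0 (ln \<bar>f x\<bar>)) \<partial>lebesgue_on X) < \<infinity>}"

definition rearrangement :: "'a::euclidean_space set \<Rightarrow> ('a \<Rightarrow> real) \<Rightarrow> real \<Rightarrow> ennreal" where
  "rearrangement X f t =
     Inf (ennreal ` {s. 0 \<le> s \<and> emeasure lebesgue {x \<in> X. \<bar>f x\<bar> > s} \<le> ennreal t})"

text \<open>\<open>ennreal\<close> truncates the negative values of the logarithm, which occur for \<open>t > |X|\<close>, to 0;
  the rearrangement vanishes there.\<close>

definition LlnL_norm :: "'a::euclidean_space set \<Rightarrow> ('a \<Rightarrow> real) \<Rightarrow> ennreal" where
  "LlnL_norm X f =
     (\<integral>\<^sup>+t\<in>{0<..}. rearrangement X f t * ennreal (ln (measure lebesgue X / t)) \<partial>lborel)"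

end

theory Submission
  imports Defs
begin

text \<open>
  The theorem is a Harnack inequality, and it follows from one fact: the mean of \<open>u\<close> over a disc
  \<open>D(x, \<rho>)\<close> inside the unit disc differs from \<open>u x\<close> by at most a multiple of the Zygmund norm \<open>N\<close>
  of \<open>f\<close> (lemma \<open>disc_mean_deviation\<close>). Since \<open>u\<close> is nonnegative, its mean over \<open>D(x, 1/5)\<close> is
  at most \<open>4\<close> times its mean over the larger disc \<open>D(y, 2/5)\<close> whenever \<open>|x - y| \<le> 1/5\<close>; hence
  \<open>u x \<le> 4 u y + N\<close> for such points, and five steps along a segment connect any two points of the
  disc of radius \<open>1/2\<close>.

  To compare the mean with the value at the centre, put
  \<open>A r = \<integral> u (x + r z) dz\<close>, integrated over the unit ball. Then \<open>A' r = \<integral> z \<bullet> \<nabla>u (x + r z) dz\<close>.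
  As \<open>-2 z\<close> is the gradient of the weight \<open>1 - |z|\<^sup>2\<close>, which vanishes on the unit sphere,
  integration by parts gives
  \<open>A' r = r/2 \<integral> (1 - |z|\<^sup>2) \<triangle>u (x + r z) dz\<close> (lemma \<open>integral_radial_derivative\<close>). No polar
  coordinates or boundary integrals occur: the vanishing of the integral of a derivative of a
  compactly supported Lipschitz function is a consequence of translation invariance of Lebesgue
  measure. In the plane, rescaling yields
  \<open>|A' r| \<le> 1/(2 r) \<integral> |f|\<close>, integrated over \<open>D(x, r)\<close>.

  A set of measure \<open>\<pi> r\<^sup>2\<close> carries at most \<open>\<integral> f\<^sup>* t dt\<close>, \<open>0 < t < \<pi> r\<^sup>2\<close>, of the mass of \<open>|f|\<close>
  (lemma \<open>nn_integral_le_integral_rearrangement\<close>). Integrating over \<open>r\<close> between \<open>0\<close> and \<open>1\<close> and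
  exchanging the integrals, the weight \<open>dr / (2 r)\<close> on \<open>t < \<pi> r\<^sup>2\<close> adds up to \<open>1/4 ln (\<pi> / t)\<close>;
  this is how the logarithm in the definition of the norm arises
  (lemma \<open>nn_integral_log_weight\<close>).
\<close>

section \<open>Decreasing rearrangements\<close>

lemma rearrangement_antimono: "s \<le> t \<Longrightarrow> rearrangement X f t \<le> rearrangement X f s"
  unfolding rearrangement_def
  by (intro Inf_superset_mono image_mono) (auto intro: order_trans ennreal_leI)

lemma borel_measurable_rearrangement [measurable]: "rearrangement X f \<in> borel_measurable borel"
proof (rule borel_measurableI_greater)
  fix y
  have "is_interval {t. y < rearrangement X f t}"
    unfolding is_interval_1 by (auto intro: less_le_trans rearrangement_antimono)
  then show "{t \<in> space borel. y < rearrangement X f t} \<in> sets borel"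
    by (simp add: real_interval_borel_measurable)
qed

text \<open>Extending \<open>f\<close> by zero produces a function that is Borel measurable on the whole space, which is
  what Fubini's theorem asks for below.\<close>

lemma rearrangement_extend_by_zero:
  "rearrangement X f = rearrangement UNIV (\<lambda>x. indicator X x * f x)"
proof -
  have "{x \<in> UNIV. s < \<bar>indicator X x * f x\<bar>} = {x \<in> X. s < \<bar>f x\<bar>}" if "0 \<le> s" for s
    using that by (auto simp: indicator_def split: if_splits)
  then have "{s. 0 \<le> s \<and> emeasure lebesgue {x \<in> UNIV. s < \<bar>indicator X x * f x\<bar>} \<le> ennreal t}
     = {s. 0 \<le> s \<and> emeasure lebesgue {x \<in> X. s < \<bar>f x\<bar>} \<le> ennreal t}" for t
    by (intro Collect_cong conj_cong) simp_all
  then show ?thesis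
    unfolding rearrangement_def by (intro ext) (simp only:)
qed

lemma le_rearrangement:
  assumes [measurable]: "f \<in> borel_measurable borel"
    and less: "ennreal t < emeasure lborel {x. \<bar>f x\<bar> > s}"
  shows "ennreal s \<le> rearrangement UNIV f t"
  unfolding rearrangement_def
proof (rule Inf_greatest)
  fix z assume "z \<in> ennreal ` {s. 0 \<le> s \<and> emeasure lebesgue {x \<in> UNIV. s < \<bar>f x\<bar>} \<le> ennreal t}"
  then obtain s' where z: "z = ennreal s'" "emeasure lebesgue {x. s' < \<bar>f x\<bar>} \<le> ennreal t"
    by auto
  have "s \<le> s'"
  proof (rule ccontr)
    assume "\<not> s \<le> s'"
    then have "emeasure lborel {x. \<bar>f x\<bar> > s} \<le> emeasure lborel {x. \<bar>f x\<bar> > s'}"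
      by (intro emeasure_mono) auto
    also have "\<dots> \<le> ennreal t"
      using z(2) by simp
    finally show False
      using less by simp
  qed
  then show "ennreal s \<le> z"
    by (simp add: z ennreal_leI)
qed

text \<open>By the layer cake formula the left-hand side is the integral over \<open>s > 0\<close> of the measure of
  \<open>A \<inter> {|f| > s}\<close>. That measure is at most both \<open>a\<close> and \<open>\<mu> s = |{|f| > s}|\<close>, so at most the
  length of the set of all \<open>t \<in> (0, a)\<close> with \<open>t < \<mu> s\<close>. Exchanging the integrals leaves, for
  each \<open>t\<close>, the length of the set of all \<open>s \<ge> 0\<close> with \<open>t < \<mu> s\<close>, and these \<open>s\<close> do not exceed the
  rearrangement at \<open>t\<close>.\<close>

lemma nn_integral_le_integral_rearrangement:
  fixes f :: "'a::euclidean_space \<Rightarrow> real"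
  assumes [measurable]: "f \<in> borel_measurable borel" "A \<in> sets borel"
    and A: "emeasure lborel A \<le> ennreal a"
  shows "(\<integral>\<^sup>+x\<in>A. ennreal \<bar>f x\<bar> \<partial>lborel) \<le> (\<integral>\<^sup>+t\<in>{0<..<a}. rearrangement UNIV f t \<partial>lborel)"
proof -
  define \<mu> where "\<mu> s = (\<integral>\<^sup>+x. indicator {x. s < \<bar>f x\<bar>} x \<partial>lborel)" for s
  have \<mu>: "\<mu> s = emeasure lborel {x. s < \<bar>f x\<bar>}" for s
    unfolding \<mu>_def by (subst nn_integral_indicator) auto
  have [measurable]: "\<mu> \<in> borel_measurable borel"
    unfolding \<mu>_def by measurable
  have "(\<integral>\<^sup>+x\<in>A. ennreal \<bar>f x\<bar> \<partial>lborel)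
      = (\<integral>\<^sup>+x. (\<integral>\<^sup>+s. indicator A x * indicator {x. s < \<bar>f x\<bar>} x * indicator {0..} s \<partial>lborel) \<partial>lborel)"
  proof (rule nn_integral_cong)
    fix x
    have "(\<integral>\<^sup>+s. indicator A x * indicator {x. s < \<bar>f x\<bar>} x * indicator {0..} s \<partial>lborel)
        = (\<integral>\<^sup>+s. indicator A x * indicator {0..<\<bar>f x\<bar>} s \<partial>lborel)"
      by (intro nn_integral_cong) (auto simp: indicator_def)
    also have "\<dots> = indicator A x * ennreal \<bar>f x\<bar>"
      by (subst nn_integral_cmult) auto
    finally show "ennreal \<bar>f x\<bar> * indicator A x
        = (\<integral>\<^sup>+s. indicator A x * indicator {x. s < \<bar>f x\<bar>} x * indicator {0..} s \<partial>lborel)"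
      by (simp add: mult.commute)
  qed
  also have "\<dots> = (\<integral>\<^sup>+s. (\<integral>\<^sup>+x. indicator A x * indicator {x. s < \<bar>f x\<bar>} x * indicator {0..} s \<partial>lborel) \<partial>lborel)"
    by (intro lborel_pair.Fubini') measurable
  also have "\<dots> \<le> (\<integral>\<^sup>+s. (\<integral>\<^sup>+t. indicator {0<..<a} t * indicator {t. ennreal t < \<mu> s} t * indicator {0..} s \<partial>lborel) \<partial>lborel)"
  proof (rule nn_integral_mono)
    fix s :: real
    define m where "m = emeasure lborel (A \<inter> {x. s < \<bar>f x\<bar>})"
    have m: "m \<le> ennreal a" "m \<le> \<mu> s"
      unfolding m_def \<mu> by (auto intro!: emeasure_mono order_trans[OF emeasure_mono A])
    obtain m' where m': "m = ennreal m'" "0 \<le> m'"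
      using m(1) by (cases m) (auto simp: top_unique)
    have lhs: "(\<integral>\<^sup>+x. indicator A x * indicator {x. s < \<bar>f x\<bar>} x * indicator {0..} s \<partial>lborel)
        = m * indicator {0..} s"
      unfolding m_def by (subst nn_integral_multc) (auto simp flip: indicator_inter_arith)
    have "m = emeasure lborel {0<..<m'}"
      using m' by simp
    also have "\<dots> = (\<integral>\<^sup>+t. indicator {0<..<m'} t \<partial>lborel)"
      by simp
    also have "\<dots> \<le> (\<integral>\<^sup>+t. indicator {0<..<a} t * indicator {t. ennreal t < \<mu> s} t \<partial>lborel)"
    proof (intro nn_integral_mono)
      fix t
      have "t < a \<and> ennreal t < \<mu> s" if "0 < t" "t < m'"
      proof -
        have "ennreal t < m"
          using that m' by (simp add: ennreal_less_iff)
        then show ?thesis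
          using m that(1) by (meson ennreal_leI leD less_le_trans not_le)
      qed
      then show "(indicator {0<..<m'} t :: ennreal) \<le> indicator {0<..<a} t * indicator {t. ennreal t < \<mu> s} t"
        by (auto simp: indicator_def)
    qed
    finally have "m * indicator {0..} s
        \<le> (\<integral>\<^sup>+t. indicator {0<..<a} t * indicator {t. ennreal t < \<mu> s} t \<partial>lborel) * indicator {0..} s"
      by (rule mult_right_mono) simp
    also have "\<dots> = (\<integral>\<^sup>+t. indicator {0<..<a} t * indicator {t. ennreal t < \<mu> s} t * indicator {0..} s \<partial>lborel)"
      by (subst nn_integral_multc) auto
    finally show "(\<integral>\<^sup>+x. indicator A x * indicator {x. s < \<bar>f x\<bar>} x * indicator {0..} s \<partial>lborel)
        \<le> (\<integral>\<^sup>+t. indicator {0<..<a} t * indicator {t. ennreal t < \<mu> s} t * indicator {0..} s \<partial>lborel)"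
      by (simp only: lhs)
  qed
  also have "\<dots> = (\<integral>\<^sup>+t. (\<integral>\<^sup>+s. indicator {0<..<a} t * indicator {t. ennreal t < \<mu> s} t * indicator {0..} s \<partial>lborel) \<partial>lborel)"
    by (intro lborel_pair.Fubini') measurable
  also have "\<dots> \<le> (\<integral>\<^sup>+t\<in>{0<..<a}. rearrangement UNIV f t \<partial>lborel)"
  proof (rule nn_integral_mono)
    fix t :: real
    have "(\<integral>\<^sup>+s. indicator {0<..<a} t * indicator {t. ennreal t < \<mu> s} t * indicator {0..} s \<partial>lborel)
        = (\<integral>\<^sup>+s. indicator {0<..<a} t * indicator {s. ennreal t < \<mu> s \<and> 0 \<le> s} s \<partial>lborel)"
      by (intro nn_integral_cong) (auto simp: indicator_def)
    also have "\<dots> = indicator {0<..<a} t * emeasure lborel {s. ennreal t < \<mu> s \<and> 0 \<le> s}"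
      by (subst nn_integral_cmult) auto
    also have "\<dots> \<le> indicator {0<..<a} t * rearrangement UNIV f t"
    proof (rule mult_left_mono, cases "rearrangement UNIV f t")
      case (real r)
      have "{s. ennreal t < \<mu> s \<and> 0 \<le> s} \<subseteq> {0..r}"
        using le_rearrangement[OF assms(1), of t] real by (auto simp: \<mu>)
      then have "emeasure lborel {s. ennreal t < \<mu> s \<and> 0 \<le> s} \<le> emeasure lborel {0..r}"
        by (intro emeasure_mono) auto
      with real show "emeasure lborel {s. ennreal t < \<mu> s \<and> 0 \<le> s} \<le> rearrangement UNIV f t"
        by simp
    qed simp_all
    finally show "(\<integral>\<^sup>+s. indicator {0<..<a} t * indicator {t. ennreal t < \<mu> s} t * indicator {0..} s \<partial>lborel)
        \<le> rearrangement UNIV f t * indicator {0<..<a} t"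
      unfolding mult.commute[of "rearrangement UNIV f t"] .
  qed
  finally show ?thesis .
qed

text \<open>After exchanging the integrals, \<open>R t\<close> is weighted by the integral of \<open>1 / (2 r)\<close> over
  \<open>sqrt (t / \<pi>) < r \<le> 1\<close>, which is \<open>-1/2 ln (sqrt (t / \<pi>)) = 1/4 ln (\<pi> / t)\<close> for \<open>t < \<pi>\<close>
  and zero otherwise.\<close>

lemma nn_integral_log_weight:
  fixes R :: "real \<Rightarrow> ennreal"
  assumes [measurable]: "R \<in> borel_measurable borel"
  shows "(\<integral>\<^sup>+r\<in>{0<..1}. ennreal (1 / (2 * r)) * (\<integral>\<^sup>+t\<in>{0<..<pi * r\<^sup>2}. R t \<partial>lborel) \<partial>lborel)
    \<le> ennreal (1/4) * (\<integral>\<^sup>+t\<in>{0<..}. R t * ennreal (ln (pi / t)) \<partial>lborel)"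
proof -
  have "(\<integral>\<^sup>+r\<in>{0<..1}. ennreal (1 / (2 * r)) * (\<integral>\<^sup>+t\<in>{0<..<pi * r\<^sup>2}. R t \<partial>lborel) \<partial>lborel)
     = (\<integral>\<^sup>+r. (\<integral>\<^sup>+t. R t * (ennreal (1 / (2 * r)) * indicator {r. 0 < r \<and> r \<le> 1 \<and> 0 < t \<and> t < pi * r\<^sup>2} r) \<partial>lborel) \<partial>lborel)"
    by (intro nn_integral_cong)
      (auto simp: indicator_def ac_simps simp flip: nn_integral_cmult intro!: nn_integral_cong)
  also have "\<dots> = (\<integral>\<^sup>+t. (\<integral>\<^sup>+r. R t * (ennreal (1 / (2 * r)) * indicator {r. 0 < r \<and> r \<le> 1 \<and> 0 < t \<and> t < pi * r\<^sup>2} r) \<partial>lborel) \<partial>lborel)"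
    by (intro lborel_pair.Fubini') measurable
  also have "\<dots> = (\<integral>\<^sup>+t. R t * (\<integral>\<^sup>+r. ennreal (1 / (2 * r)) * indicator {r. 0 < r \<and> r \<le> 1 \<and> 0 < t \<and> t < pi * r\<^sup>2} r \<partial>lborel) \<partial>lborel)"
    by (intro nn_integral_cong nn_integral_cmult) measurable
  also have "\<dots> \<le> (\<integral>\<^sup>+t. ennreal (1/4) * (R t * ennreal (ln (pi / t)) * indicator {0<..} t) \<partial>lborel)"
  proof (rule nn_integral_mono)
    fix t :: real
    have "(\<integral>\<^sup>+r. ennreal (1 / (2 * r)) * indicator {r. 0 < r \<and> r \<le> 1 \<and> 0 < t \<and> t < pi * r\<^sup>2} r \<partial>lborel)
       \<le> ennreal (1/4) * (ennreal (ln (pi / t)) * indicator {0<..} t)"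
    proof (cases "0 < t \<and> t < pi")
      case True
      define q where "q = sqrt (t / pi)"
      have q: "0 < q" "q \<le> 1" "q\<^sup>2 = t / pi"
        using True by (auto simp: q_def)
      have "(\<integral>\<^sup>+r. ennreal (1 / (2 * r)) * indicator {r. 0 < r \<and> r \<le> 1 \<and> 0 < t \<and> t < pi * r\<^sup>2} r \<partial>lborel)
          \<le> (\<integral>\<^sup>+r. ennreal (1 / (2 * r)) * indicator {q..1} r \<partial>lborel)"
      proof (intro nn_integral_mono mult_left_mono)
        fix r :: real
        have "q \<le> r" if "0 < r" "t < pi * r\<^sup>2"
        proof -
          have "q\<^sup>2 \<le> r\<^sup>2" unfolding q(3) using that by (simp add: field_simps)
          then show ?thesis using that by (auto intro: power2_le_imp_le)
        qed
        then show "(indicator {r. 0 < r \<and> r \<le> 1 \<and> 0 < t \<and> t < pi * r\<^sup>2} r :: ennreal) \<le> indicator {q..1} r"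
          by (auto simp: indicator_def)
      qed simp
      also have "\<dots> = ennreal (ln 1 / 2 - ln q / 2)"
        using q by (intro nn_integral_FTC_Icc) (auto intro!: derivative_eq_intros simp: field_simps)
      also have "ln 1 / 2 - ln q / 2 = (1/4) * ln (pi / t)"
        using True by (simp add: q_def ln_sqrt ln_div field_simps)
      finally show ?thesis
        using True ennreal_mult'[of "1/4" "ln (pi / t)"] by simp
    next
      case False
      have "indicator {r. 0 < r \<and> r \<le> 1 \<and> 0 < t \<and> t < pi * r\<^sup>2} r = (0::ennreal)" for r
      proof -
        have "t < pi" if "0 < r" "r \<le> 1" "t < pi * r\<^sup>2"
        proof -
          have "pi * r\<^sup>2 \<le> pi" using that by (simp add: power_le_one)
          then show ?thesis using that by linarith
        qed
        then show ?thesis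
          using False by (auto simp: indicator_def)
      qed
      then show ?thesis by simp
    qed
    then have "R t * (\<integral>\<^sup>+r. ennreal (1 / (2 * r)) * indicator {r. 0 < r \<and> r \<le> 1 \<and> 0 < t \<and> t < pi * r\<^sup>2} r \<partial>lborel)
       \<le> R t * (ennreal (1/4) * (ennreal (ln (pi / t)) * indicator {0<..} t))"
      by (rule mult_left_mono) simp
    then show "R t * (\<integral>\<^sup>+r. ennreal (1 / (2 * r)) * indicator {r. 0 < r \<and> r \<le> 1 \<and> 0 < t \<and> t < pi * r\<^sup>2} r \<partial>lborel)
       \<le> ennreal (1/4) * (R t * ennreal (ln (pi / t)) * indicator {0<..} t)"
      by (simp add: ac_simps)
  qed
  also have "\<dots> = ennreal (1/4) * (\<integral>\<^sup>+t\<in>{0<..}. R t * ennreal (ln (pi / t)) \<partial>lborel)"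
    by (rule nn_integral_cmult) measurable
  finally show ?thesis .
qed

section \<open>Integration by parts on the unit ball\<close>

text \<open>The difference quotients \<open>(V (x + h e) - V x) / h\<close> have integral zero by translation
  invariance. The Lipschitz bound dominates them, and they converge to the derivative off the unit
  sphere, which is a null set, so the derivative has integral zero as well. The integrand is called
  \<open>G\<close> because on the sphere, where \<open>V\<close> need not be differentiable, it is only required to be the
  continuous extension.\<close>

lemma integral_directional_derivative_eq_0:
  fixes V :: "'a::euclidean_space \<Rightarrow> real"
  assumes lip: "\<And>x y. \<bar>V x - V y\<bar> \<le> L * norm (x - y)"
    and supp: "\<And>x. x \<notin> ball 0 1 \<Longrightarrow> V x = 0"
    and der: "\<And>x. x \<in> ball 0 1 \<Longrightarrow> (V has_derivative D x) (at x)"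
    and cont: "continuous_on (cball 0 1) G"
    and G: "\<And>x. x \<in> ball 0 1 \<Longrightarrow> G x = D x e"
  shows "(LINT x:cball 0 1|lborel. G x) = 0"
proof -
  have "L-lipschitz_on UNIV V" if "L \<ge> 0"
    using lip that by (intro lipschitz_onI) (auto simp: dist_norm)
  moreover have "L \<ge> 0"
  proof -
    obtain b :: 'a where "b \<in> Basis" using nonempty_Basis by blast
    then show ?thesis using lip[of b 0] by simp
  qed
  ultimately have "continuous_on UNIV V"
    by (simp add: lipschitz_on_continuous_on)
  then have [measurable]: "V \<in> borel_measurable borel"
    by (rule borel_measurable_continuous_onI)
  define h :: "nat \<Rightarrow> real" where "h n = 1 / Suc n" for n
  have h: "h n > 0" "h n \<le> 1" for n by (auto simp: h_def field_simps)
  define s where "s n x = (V (x + h n *\<^sub>R e) - V x) / h n" for n x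
  have V_int: "integrable lborel V"
  proof -
    have "integrable lborel (\<lambda>x. indicator (cball 0 1) x *\<^sub>R V x)"
      using \<open>continuous_on UNIV V\<close>
      by (intro borel_integrable_compact) (auto intro: continuous_on_subset)
    also have "(\<lambda>x. indicator (cball 0 1) x *\<^sub>R V x) = V"
    proof (rule ext)
      fix x show "indicator (cball 0 1) x *\<^sub>R V x = V x"
        using supp[of x] by (cases "norm x \<le> 1") auto
    qed
    finally show ?thesis .
  qed
  have s0: "integral\<^sup>L lborel (s n) = 0" for n
  proof -
    have "integral\<^sup>L lborel V = integral\<^sup>L (distr lborel borel ((+) (h n *\<^sub>R e))) V"
      by (simp add: lborel_distr_plus)
    also have "\<dots> = (\<integral>x. V (x + h n *\<^sub>R e) \<partial>lborel)"
      by (subst integral_distr) (auto simp: add.commute)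
    finally have eq: "(\<integral>x. V (x + h n *\<^sub>R e) \<partial>lborel) = integral\<^sup>L lborel V" ..
    have "integrable (distr lborel borel ((+) (h n *\<^sub>R e))) V"
      using V_int by (simp add: lborel_distr_plus)
    then have "integrable lborel (\<lambda>x. V (x + h n *\<^sub>R e))"
      by (subst (asm) integrable_distr_eq) (auto simp: add.commute)
    then show ?thesis
      using V_int eq unfolding s_def by simp
  qed
  have G_meas [measurable]: "(\<lambda>x. indicator (cball 0 1) x *\<^sub>R G x) \<in> borel_measurable borel"
    using cont by (intro borel_measurable_continuous_on_indicator) auto
  have "(\<lambda>n. integral\<^sup>L lborel (s n)) \<longlonglongrightarrow> (\<integral>x. indicator (cball 0 1) x *\<^sub>R G x \<partial>lborel)"
  proof (rule integral_dominated_convergence)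
    show "integrable lborel (\<lambda>x. (L * norm e) * indicator (cball 0 (1 + norm e)) x)"
      by (intro integrable_mult_right integrable_real_indicator) (use emeasure_bounded_finite[OF bounded_cball] in auto)
    show "s n \<in> borel_measurable lborel" for n
      unfolding s_def by measurable
    show "AE x in lborel. norm (s n x) \<le> (L * norm e) * indicator (cball 0 (1 + norm e)) x" for n
    proof (rule AE_I2)
      fix x
      show "norm (s n x) \<le> (L * norm e) * indicator (cball 0 (1 + norm e)) x"
      proof (cases "norm x \<le> 1 + norm e")
        case True
        have "\<bar>V (x + h n *\<^sub>R e) - V x\<bar> \<le> L * (h n * norm e)"
          using lip[of "x + h n *\<^sub>R e" x] h(1)[of n] by simp
        then show ?thesis
          using True h(1)[of n] by (simp add: s_def field_simps)
      next
        case False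
        have "h n * norm e \<le> norm e"
          using h[of n] by (simp add: mult_left_le_one_le)
        then have "norm (x + h n *\<^sub>R e) \<ge> 1" "norm x \<ge> 1"
          using False norm_triangle_ineq4[of "x + h n *\<^sub>R e" "h n *\<^sub>R e"] h(1)[of n] norm_ge_zero[of e]
          by (auto simp del: norm_ge_zero)
        then have "V (x + h n *\<^sub>R e) = 0" "V x = 0"
          by (auto intro!: supp)
        then show ?thesis
          using \<open>L \<ge> 0\<close> by (simp add: s_def)
      qed
    qed
    have "sphere (0::'a) 1 \<in> null_sets lborel"
      using negligible_sphere[of "0::'a" 1] by (auto simp: null_sets_completion_iff negligible_iff_null_sets)
    then have "AE x in lborel. x \<notin> sphere (0::'a) 1"
      by (rule AE_not_in)
    then show "AE x in lborel. (\<lambda>n. s n x) \<longlonglongrightarrow> indicator (cball 0 1) x *\<^sub>R G x"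
    proof (rule AE_mp, intro AE_I2 impI)
      fix x :: 'a assume "x \<notin> sphere 0 1"
      then consider "norm x < 1" | "norm x > 1" by (auto simp: dist_norm) fastforce
      moreover have diff_quot: "(\<lambda>n. s n x) \<longlonglongrightarrow> E e" if "(V has_derivative E) (at x)" for E
      proof -
        have "((\<lambda>t. V (x + t *\<^sub>R e)) has_derivative (\<lambda>t. E (t *\<^sub>R e))) (at (0::real))"
          using that by (intro has_derivative_compose[of "\<lambda>t. x + t *\<^sub>R e" _ _ _ V, simplified])
            (auto intro!: derivative_eq_intros)
        moreover have "(\<lambda>t. E (t *\<^sub>R e)) = (*) (E e)"
          using linear_scale[OF has_derivative_linear[OF that]] by (simp add: fun_eq_iff)
        ultimately have "((\<lambda>t. V (x + t *\<^sub>R e)) has_real_derivative E e) (at 0)"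
          unfolding has_field_derivative_def by (simp only:)
        then have "(\<lambda>t. (V (x + t *\<^sub>R e) - V x) / t) \<midarrow>0\<rightarrow> E e"
          by (simp add: DERIV_def)
        moreover have "h \<longlonglongrightarrow> 0"
          unfolding h_def using LIMSEQ_inverse_real_of_nat by (simp add: inverse_eq_divide)
        then have "filterlim h (at 0) sequentially"
          using h(1) by (intro filterlim_atI) (auto intro!: always_eventually simp: less_imp_neq[THEN not_sym])
        ultimately show ?thesis
          unfolding s_def by (rule filterlim_compose)
      qed
      ultimately show "(\<lambda>n. s n x) \<longlonglongrightarrow> indicator (cball 0 1) x *\<^sub>R G x"
      proof cases
        case 1
        then show ?thesis using diff_quot[OF der] G[of x] by simp
      next
        case 2
        have "(V has_derivative (\<lambda>_. 0)) (at x)"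
        proof (rule has_derivative_transform_within_open)
          show "((\<lambda>_. 0) has_derivative (\<lambda>_. 0)) (at x)" by simp
          show "open (- cball (0::'a) 1)" by (simp add: open_Compl)
          show "0 = V y" if "y \<in> - cball 0 1" for y
            using that by (simp add: supp)
        qed (use 2 in auto)
        then show ?thesis using diff_quot 2 by force
      qed
    qed
  qed (use G_meas in simp)
  then show ?thesis
    unfolding s0 set_lebesgue_integral_def using LIMSEQ_unique tendsto_const by blast
qed

lemma frechet_derivative_eq_sum_partial:
  fixes g :: "'a::euclidean_space \<Rightarrow> real"
  assumes "g differentiable (at y)"
  shows "frechet_derivative g (at y) v = (\<Sum>b\<in>Basis. (v \<bullet> b) * partial_derivative b g y)"
proof -
  have lin: "linear (frechet_derivative g (at y))"
    using assms by (rule linear_frechet_derivative)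
  have "frechet_derivative g (at y) v = frechet_derivative g (at y) (\<Sum>b\<in>Basis. (v \<bullet> b) *\<^sub>R b)"
    by (simp add: euclidean_representation)
  also have "\<dots> = (\<Sum>b\<in>Basis. (v \<bullet> b) * partial_derivative b g y)"
    by (simp add: linear_sum[OF lin] linear_scale[OF lin] partial_derivative_def)
  finally show ?thesis .
qed

lemma Ck_on_1D:
  assumes "Ck_on (Suc 0) S g"
  shows "\<And>y. y \<in> S \<Longrightarrow> g differentiable (at y)"
    and "continuous_on S (partial_derivative b g)"
    and "continuous_on S g"
  using assms by (auto simp: partial_derivative_def[abs_def] intro!: differentiable_imp_continuous_on
      differentiable_at_imp_differentiable_on)

lemma Ck_on_2D:
  assumes "Ck_on 2 S u"
  shows "\<And>y. y \<in> S \<Longrightarrow> u differentiable (at y)"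
    and "Ck_on (Suc 0) S (partial_derivative b u)"
  using assms by (simp_all add: partial_derivative_def[abs_def] numeral_2_eq_2)

lemma Ck_on_1_bounded_Lipschitz:
  fixes g :: "'a::euclidean_space \<Rightarrow> real"
  assumes C1: "Ck_on (Suc 0) S g" and K: "compact K" "convex K" "K \<subseteq> S"
  obtains L where "L \<ge> 0" "\<And>y z. y \<in> K \<Longrightarrow> z \<in> K \<Longrightarrow> \<bar>g y - g z\<bar> \<le> L * norm (y - z)"
    "\<And>y. y \<in> K \<Longrightarrow> \<bar>g y\<bar> \<le> L"
proof -
  have bound: "\<exists>B. \<forall>y\<in>K. \<bar>w y\<bar> \<le> B" if "continuous_on S w" for w :: "'a \<Rightarrow> real"
  proof -
    have "bounded (w ` K)"
      using that K by (intro compact_imp_bounded compact_continuous_image) (auto intro: continuous_on_subset)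
    then show ?thesis by (auto simp: bounded_iff)
  qed
  obtain M where M: "\<And>y. y \<in> K \<Longrightarrow> \<bar>g y\<bar> \<le> M"
    using bound[OF Ck_on_1D(3)[OF C1]] by blast
  have "\<forall>b. \<exists>B. \<forall>y\<in>K. \<bar>partial_derivative b g y\<bar> \<le> B"
    using bound[OF Ck_on_1D(2)[OF C1]] by blast
  then obtain B where B: "\<And>b y. y \<in> K \<Longrightarrow> \<bar>partial_derivative b g y\<bar> \<le> B b"
    by metis
  define L where "L = (\<Sum>b\<in>Basis. B b)"
  have lip: "\<bar>g y - g z\<bar> \<le> L * norm (y - z)" if "y \<in> K" "z \<in> K" for y z
  proof -
    have "norm (g y - g z) \<le> L * norm (y - z)"
    proof (rule differentiable_bound[OF \<open>convex K\<close>])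
      show "(g has_derivative frechet_derivative g (at y)) (at y within K)" if "y \<in> K" for y
        using Ck_on_1D(1)[OF C1, of y] that K(3)
        by (auto intro: has_derivative_at_withinI simp: frechet_derivative_works)
      show "onorm (frechet_derivative g (at y)) \<le> L" if "y \<in> K" for y
      proof (rule onorm_le)
        fix v
        have "\<bar>frechet_derivative g (at y) v\<bar> = \<bar>\<Sum>b\<in>Basis. (v \<bullet> b) * partial_derivative b g y\<bar>"
          using Ck_on_1D(1)[OF C1, of y] that K(3) by (subst frechet_derivative_eq_sum_partial) auto
        also have "\<dots> \<le> (\<Sum>b\<in>Basis. norm v * B b)"
          using B[OF that] by (intro order_trans[OF sum_abs] sum_mono)
            (auto simp: abs_mult Basis_le_norm intro!: mult_mono)
        finally show "norm (frechet_derivative g (at y) v) \<le> L * norm v"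
          by (simp add: L_def sum_distrib_left mult.commute)
      qed
    qed (use that in auto)
    then show ?thesis by simp
  qed
  show ?thesis
  proof
    show "max 0 (max L M) \<ge> 0" by simp
    show "\<bar>g y - g z\<bar> \<le> max 0 (max L M) * norm (y - z)" if "y \<in> K" "z \<in> K" for y z
      using lip[OF that] by (rule order_trans) (auto intro: mult_right_mono)
    show "\<bar>g y\<bar> \<le> max 0 (max L M)" if "y \<in> K" for y
      using M[OF that] by linarith
  qed
qed

text \<open>The weight is \<open>1 - n\<^sup>2\<close> for \<open>n = min 1 |z|\<close>, and \<open>n\<^sup>2\<close> is 2-Lipschitz because \<open>n \<le> 1\<close>.\<close>

lemma bump_Lipschitz:
  fixes y z :: "'a::euclidean_space"
  shows "\<bar>max 0 (1 - y \<bullet> y) - max 0 (1 - z \<bullet> z)\<bar> \<le> 2 * norm (y - z)"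
proof -
  have *: "max 0 (1 - y \<bullet> y) - max 0 (1 - z \<bullet> z) \<le> 2 * norm (y - z)" for y z :: 'a
  proof (cases "norm y \<le> 1")
    case True
    have "norm z - norm y \<le> norm (y - z)"
      by (metis norm_minus_commute norm_triangle_ineq2)
    have eq: "y \<bullet> y = (norm y)\<^sup>2" "z \<bullet> z = (norm z)\<^sup>2"
      by (simp_all add: power2_norm_eq_inner)
    define n where "n = min 1 (norm z)"
    have n: "n \<le> 1" "0 \<le> n" "max 0 (1 - z \<bullet> z) = 1 - n\<^sup>2"
      using abs_square_le_1[of "norm z"] by (auto simp: n_def eq min_def max_def)
    have y1: "max 0 (1 - y \<bullet> y) = 1 - (norm y)\<^sup>2"
      using True power_le_one[of "norm y" 2] by (simp add: eq max_def)
    have "max 0 (1 - y \<bullet> y) - max 0 (1 - z \<bullet> z) = (n + norm y) * (n - norm y)"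
      unfolding n(3) y1 by (simp add: power2_eq_square algebra_simps)
    also have "\<dots> \<le> (n + norm y) * norm (y - z)"
      using \<open>norm z - norm y \<le> norm (y - z)\<close> n by (intro mult_left_mono) (auto simp: n_def)
    also have "\<dots> \<le> 2 * norm (y - z)"
      using True n by (intro mult_right_mono) auto
    finally show ?thesis .
  next
    case False
    then have "1 - y \<bullet> y \<le> 0"
      by (metis diff_le_0_iff_le less_eq_real_def not_le one_le_power power2_norm_eq_inner)
    then have "max 0 (1 - y \<bullet> y) = 0" by simp
    moreover have "0 \<le> max 0 (1 - z \<bullet> z)" by simp
    ultimately show ?thesis
      using norm_ge_zero[of "y - z"] by linarith
  qed
  show ?thesis
    using *[of y z] *[of z y] by (simp add: abs_le_iff norm_minus_commute)
qed

lemma set_integrable_cball: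
  fixes F :: "'a::euclidean_space \<Rightarrow> real"
  shows "continuous_on (cball c r) F \<Longrightarrow> set_integrable lborel (cball c r) F"
  unfolding set_integrable_def by (intro borel_integrable_compact) auto

text \<open>For each basis vector \<open>b\<close> the function \<open>V z = (1 - |z|\<^sup>2) \<partial>\<^sub>b u (x + r z)\<close>, cut off outside the
  unit ball, is Lipschitz. Its derivative in direction \<open>b\<close> is
  \<open>r (1 - |z|\<^sup>2) \<partial>\<^sub>b\<partial>\<^sub>b u (x + r z) - 2 (z \<bullet> b) \<partial>\<^sub>b u (x + r z)\<close> and integrates to zero. The
  identity is the sum of these equations over \<open>b\<close>.\<close>

lemma integral_radial_derivative:
  fixes u :: "'a::euclidean_space \<Rightarrow> real"
  assumes C2: "Ck_on 2 S u" and S: "cball x r \<subseteq> S" and r: "0 \<le> r"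
  shows "(LINT z:cball 0 1|lborel. frechet_derivative u (at (x + r *\<^sub>R z)) z)
    = (r / 2) * (LINT z:cball 0 1|lborel. (1 - z \<bullet> z) * laplacian u (x + r *\<^sub>R z))"
proof -
  have mem: "x + r *\<^sub>R z \<in> cball x r" if "z \<in> cball 0 1" for z
    using that r by (simp add: dist_norm mult_left_le)
  have memS: "x + r *\<^sub>R z \<in> S" if "norm z \<le> 1" for z
    using S mem[of z] that by auto
  have cont: "continuous_on (cball 0 1) (\<lambda>z. w (x + r *\<^sub>R z))" if "continuous_on S w" for w :: "'a \<Rightarrow> real"
    by (rule continuous_on_compose2[OF that]) (auto intro!: continuous_intros memS)
  define g where "g b = partial_derivative b u" for b
  have g: "Ck_on (Suc 0) S (g b)" for b
    unfolding g_def using C2 by (rule Ck_on_2D)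
  define H where "H b z = (1 - z \<bullet> z) * (r * partial_derivative b (g b) (x + r *\<^sub>R z))
    - 2 * (z \<bullet> b) * g b (x + r *\<^sub>R z)" for b z
  have H_cont: "continuous_on (cball 0 1) (H b)" for b
    unfolding H_def by (intro continuous_intros cont Ck_on_1D[OF g])
  have H0: "(LINT z:cball 0 1|lborel. H b z) = 0" for b
  proof -
    obtain L where L: "L \<ge> 0"
      "\<And>y z. y \<in> cball x r \<Longrightarrow> z \<in> cball x r \<Longrightarrow> \<bar>g b y - g b z\<bar> \<le> L * norm (y - z)"
      "\<And>y. y \<in> cball x r \<Longrightarrow> \<bar>g b y\<bar> \<le> L"
      using Ck_on_1_bounded_Lipschitz[OF g _ _ S] by auto
    \<comment> \<open>The maximum cuts \<open>V\<close> off outside the ball, where \<open>x + r z\<close> may leave \<open>S\<close>.\<close>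
    define V where "V z = max 0 (1 - z \<bullet> z) * g b (x + r *\<^sub>R z)" for z
    have V0: "V z = 0" if "1 \<le> norm z" for z
    proof -
      have "1 - z \<bullet> z \<le> 0"
        using one_le_power[OF that, of 2] by (simp add: power2_norm_eq_inner)
      then show ?thesis by (simp add: V_def max_def)
    qed
    \<comment> \<open>One point in the closed ball suffices; if the other lies outside, the weight alone controls
      the difference, since it vanishes there.\<close>
    have V_lip_in: "\<bar>V y - V z\<bar> \<le> (L * r + 2 * L) * norm (y - z)" if "norm y \<le> 1" for y z
    proof (cases "norm z \<le> 1")
      case True
      have "V y - V z = max 0 (1 - z \<bullet> z) * (g b (x + r *\<^sub>R y) - g b (x + r *\<^sub>R z))
          + (max 0 (1 - y \<bullet> y) - max 0 (1 - z \<bullet> z)) * g b (x + r *\<^sub>R y)"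
        by (simp add: V_def algebra_simps)
      also have "\<bar>\<dots>\<bar> \<le> 1 * (L * (r * norm (y - z))) + 2 * norm (y - z) * L"
      proof (rule order_trans[OF abs_triangle_ineq], unfold abs_mult, intro add_mono mult_mono)
        show "\<bar>g b (x + r *\<^sub>R y) - g b (x + r *\<^sub>R z)\<bar> \<le> L * (r * norm (y - z))"
          using L(2)[OF mem mem, of y z] that True r by (simp flip: scaleR_diff_right)
      qed (use bump_Lipschitz[of y z] L(3)[OF mem, of y] that L(1) r in auto)
      finally show ?thesis by (simp add: algebra_simps)
    next
      case False
      then have "V z = 0" "max 0 (1 - z \<bullet> z) = 0"
        using V0[of z] one_le_power[of "norm z" 2] by (auto simp: power2_norm_eq_inner)
      then have "\<bar>V y - V z\<bar> = \<bar>max 0 (1 - y \<bullet> y) - max 0 (1 - z \<bullet> z)\<bar> * \<bar>g b (x + r *\<^sub>R y)\<bar>"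
        by (simp add: V_def abs_mult)
      also have "\<dots> \<le> 2 * norm (y - z) * L"
        using bump_Lipschitz[of y z] L(3)[OF mem, of y] that by (intro mult_mono) auto
      also have "\<dots> \<le> (L * r + 2 * L) * norm (y - z)"
        using L(1) r by (simp add: algebra_simps)
      finally show ?thesis .
    qed
    have V_lip: "\<bar>V y - V z\<bar> \<le> (L * r + 2 * L) * norm (y - z)" for y z
      using V_lip_in[of y z] V_lip_in[of z y] V0[of y] V0[of z] L(1) r
      by (cases "norm y \<le> 1"; cases "norm z \<le> 1") (auto simp: norm_minus_commute abs_minus_commute)
    define D where "D z h = (1 - z \<bullet> z) * frechet_derivative (g b) (at (x + r *\<^sub>R z)) (r *\<^sub>R h)
        - 2 * (z \<bullet> h) * g b (x + r *\<^sub>R z)" for z h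
    show ?thesis
    proof (rule integral_directional_derivative_eq_0[where V = V and D = D and e = b])
      show "\<And>y z. \<bar>V y - V z\<bar> \<le> (L * r + 2 * L) * norm (y - z)" by (fact V_lip)
      show "\<And>z. z \<notin> ball 0 1 \<Longrightarrow> V z = 0" by (auto intro: V0)
      show "continuous_on (cball 0 1) (H b)" by (fact H_cont)
      fix z :: 'a assume z: "z \<in> ball 0 1"
      have diff: "g b differentiable (at (x + r *\<^sub>R z))"
        using z by (intro Ck_on_1D[OF g] memS) simp
      then have "linear (frechet_derivative (g b) (at (x + r *\<^sub>R z)))"
        by (rule linear_frechet_derivative)
      then show "H b z = D z b"
        by (simp add: H_def D_def linear_scale partial_derivative_def)
      have "((\<lambda>z. (1 - z \<bullet> z) * g b (x + r *\<^sub>R z)) has_derivative D z) (at z)"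
      proof -
        have "((\<lambda>z. g b (x + r *\<^sub>R z)) has_derivative
            (\<lambda>h. frechet_derivative (g b) (at (x + r *\<^sub>R z)) (r *\<^sub>R h))) (at z)"
          by (rule has_derivative_compose[of "\<lambda>z. x + r *\<^sub>R z" "\<lambda>h. r *\<^sub>R h" _ _ "g b"])
            (use diff in \<open>auto intro!: derivative_eq_intros simp: frechet_derivative_works\<close>)
        then show ?thesis
          by (auto intro!: derivative_eq_intros simp: D_def fun_eq_iff inner_commute algebra_simps)
      qed
      then show "(V has_derivative D z) (at z)"
      proof (rule has_derivative_transform_within_open)
        show "open (ball (0::'a) 1)" by simp
        show "(1 - y \<bullet> y) * g b (x + r *\<^sub>R y) = V y" if "y \<in> ball 0 1" for y
        proof -
          have "y \<bullet> y \<le> 1"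
            using that by (simp add: flip: power2_norm_eq_inner) (simp add: abs_square_le_1)
          then show ?thesis by (simp add: V_def max_def)
        qed
      qed (use z in auto)
    qed
  qed
  have diff: "u differentiable (at (x + r *\<^sub>R z))" if "z \<in> cball 0 1" for z
    using that by (intro Ck_on_2D(1)[OF C2] memS) simp
  have sum_H: "(\<Sum>b\<in>Basis. H b z) = r * ((1 - z \<bullet> z) * laplacian u (x + r *\<^sub>R z))
      - 2 * frechet_derivative u (at (x + r *\<^sub>R z)) z" if "z \<in> cball 0 1" for z
    unfolding frechet_derivative_eq_sum_partial[OF diff[OF that]] laplacian_def H_def g_def
    by (simp add: sum_subtractf sum_distrib_left sum_distrib_right sum.distrib algebra_simps)
  have int_lap: "set_integrable lborel (cball 0 1) (\<lambda>z. (1 - z \<bullet> z) * laplacian u (x + r *\<^sub>R z))"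
    unfolding laplacian_def g_def[symmetric]
    by (intro set_integrable_cball continuous_intros cont Ck_on_1D[OF g])
  have int_rad: "set_integrable lborel (cball 0 1) (\<lambda>z. frechet_derivative u (at (x + r *\<^sub>R z)) z)"
  proof -
    have "continuous_on (cball 0 1) (\<lambda>z. \<Sum>b\<in>Basis. (z \<bullet> b) * g b (x + r *\<^sub>R z))"
      by (intro continuous_intros cont Ck_on_1D[OF g])
    then have "continuous_on (cball 0 1) (\<lambda>z. frechet_derivative u (at (x + r *\<^sub>R z)) z)"
      by (rule continuous_on_eq) (simp add: frechet_derivative_eq_sum_partial[OF diff] g_def)
    then show ?thesis by (rule set_integrable_cball)
  qed
  have "0 = (\<Sum>b\<in>Basis. LINT z:cball 0 1|lborel. H b z)"
    by (simp add: H0)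
  also have "\<dots> = (LINT z:cball 0 1|lborel. (\<Sum>b\<in>Basis. H b z))"
    using set_integrable_cball[OF H_cont]
    unfolding set_lebesgue_integral_def set_integrable_def scaleR_sum_right
    by (subst Bochner_Integration.integral_sum) auto
  also have "\<dots> = (LINT z:cball 0 1|lborel. r * ((1 - z \<bullet> z) * laplacian u (x + r *\<^sub>R z))
      - 2 * frechet_derivative u (at (x + r *\<^sub>R z)) z)"
    by (intro set_lebesgue_integral_cong) (auto simp: sum_H)
  also have "\<dots> = r * (LINT z:cball 0 1|lborel. (1 - z \<bullet> z) * laplacian u (x + r *\<^sub>R z))
      - 2 * (LINT z:cball 0 1|lborel. frechet_derivative u (at (x + r *\<^sub>R z)) z)"
    using int_lap int_rad by (subst set_integral_diff(2)) simp_all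
  finally show ?thesis by simp
qed

section \<open>The deviation of ball averages from the value at the centre\<close>

text \<open>The fundamental theorem of calculus on each ray writes \<open>u (x + \<rho> z) - u x\<close> as the integral of
  the radial derivative. Integrating over \<open>z\<close> first, the inner integral is the one computed in
  \<open>integral_radial_derivative\<close>, where the weight \<open>1 - |z|\<^sup>2\<close> is at most \<open>1\<close>.\<close>

lemma mean_value_deviation:
  fixes u :: "'a::euclidean_space \<Rightarrow> real"
  assumes C2: "Ck_on 2 S u" and S: "cball x \<rho> \<subseteq> S" and \<rho>: "0 \<le> \<rho>"
  shows "ennreal \<bar>(LINT z:cball 0 1|lborel. u (x + \<rho> *\<^sub>R z)) - measure lborel (cball (0::'a) 1) * u x\<bar>
    \<le> (\<integral>\<^sup>+r\<in>{0<..\<rho>}. ennreal (r / 2) *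
          (\<integral>\<^sup>+z\<in>cball 0 1. ennreal \<bar>laplacian u (x + r *\<^sub>R z)\<bar> \<partial>lborel) \<partial>lborel)"
proof -
  define P where "P z r = frechet_derivative u (at (x + r *\<^sub>R z)) z" for z r
  have memS: "x + r *\<^sub>R z \<in> S" if "norm z \<le> 1" "0 \<le> r" "r \<le> \<rho>" for z r
  proof -
    have "r * norm z \<le> \<rho> * 1"
      using that by (intro mult_mono) auto
    then have "x + r *\<^sub>R z \<in> cball x \<rho>"
      using that by (simp add: dist_norm)
    then show ?thesis using S by auto
  qed
  have diff: "u differentiable (at (x + r *\<^sub>R z))" if "norm z \<le> 1" "0 \<le> r" "r \<le> \<rho>" for z r
    using that by (intro Ck_on_2D(1)[OF C2] memS)
  have u_cont: "continuous_on S u"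
    using Ck_on_2D(1)[OF C2] by (simp add: differentiable_at_imp_differentiable_on differentiable_imp_continuous_on)
  have P_cont: "continuous_on (cball 0 1 \<times> {0..\<rho>}) (case_prod P)"
  proof -
    have "continuous_on (cball 0 1 \<times> {0..\<rho>})
        (\<lambda>p. \<Sum>b\<in>Basis. (fst p \<bullet> b) * partial_derivative b u (x + snd p *\<^sub>R fst p))"
      by (intro continuous_intros continuous_on_compose2[OF Ck_on_1D(3)[OF Ck_on_2D(2)[OF C2]]])
        (auto intro!: memS)
    then show ?thesis
      by (rule continuous_on_eq) (auto simp: P_def frechet_derivative_eq_sum_partial[OF diff])
  qed
  have FTC: "(LINT r:{0..\<rho>}|lborel. P z r) = u (x + \<rho> *\<^sub>R z) - u x" if z: "z \<in> cball 0 1" for z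
  proof -
    have "(LINT r:{0..\<rho>}|lborel. P z r) = u (x + \<rho> *\<^sub>R z) - u (x + 0 *\<^sub>R z)"
      unfolding set_lebesgue_integral_def
    proof (rule integral_FTC_Icc)
      show "((\<lambda>r. u (x + r *\<^sub>R z)) has_vector_derivative P z r) (at r within {0..\<rho>})"
        if "0 \<le> r" "r \<le> \<rho>" for r
      proof -
        have d: "(u has_derivative frechet_derivative u (at (x + r *\<^sub>R z))) (at (x + r *\<^sub>R z))"
          using diff[of z r] z that by (simp add: frechet_derivative_works)
        have "((\<lambda>r. u (x + r *\<^sub>R z)) has_derivative
            (\<lambda>h. frechet_derivative u (at (x + r *\<^sub>R z)) (h *\<^sub>R z))) (at r within {0..\<rho>})"
          by (rule has_derivative_compose[of "\<lambda>r. x + r *\<^sub>R z" "\<lambda>h. h *\<^sub>R z" _ _ u])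
            (use d in \<open>auto intro!: derivative_eq_intros\<close>)
        then show ?thesis
          using linear_scale[OF has_derivative_linear[OF d]]
          by (simp add: has_vector_derivative_def P_def)
      qed
      show "continuous_on {0..\<rho>} (P z)"
      proof -
        have "continuous_on {0..\<rho>} (\<lambda>r. case_prod P (z, r))"
        proof (rule continuous_on_compose2[OF P_cont])
          show "continuous_on {0..\<rho>} (\<lambda>r. (z, r))"
            by (rule continuous_on_Pair[OF continuous_on_const continuous_on_id])
          show "(\<lambda>r. (z, r)) ` {0..\<rho>} \<subseteq> cball 0 1 \<times> {0..\<rho>}"
            using z by auto
        qed
        then show ?thesis by simp
      qed
    qed (fact \<rho>)
    then show ?thesis by simp
  qed
  define Q where "Q z r = indicator (cball 0 1 \<times> {0..\<rho>}) (z, r) *\<^sub>R P z r" for z r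
  have Q_int: "integrable (lborel \<Otimes>\<^sub>M lborel) (case_prod Q)"
  proof -
    have "integrable lborel (\<lambda>p. indicator (cball 0 1 \<times> {0..\<rho>}) p *\<^sub>R case_prod P p)"
      by (intro borel_integrable_compact P_cont compact_Times) auto
    also have "(\<lambda>p. indicator (cball 0 1 \<times> {0..\<rho>}) p *\<^sub>R case_prod P p) = case_prod Q"
      by (auto simp: Q_def)
    finally show ?thesis by (simp add: lborel_prod)
  qed
  have Q_z: "(\<integral>r. Q z r \<partial>lborel) = indicator (cball 0 1) z *\<^sub>R (u (x + \<rho> *\<^sub>R z) - u x)" for z
  proof (cases "z \<in> cball 0 1")
    case True
    then show ?thesis
      using FTC[OF True] by (simp add: Q_def set_lebesgue_integral_def indicator_times)
  qed (simp add: Q_def indicator_times)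
  have Q_r: "(\<integral>z. Q z r \<partial>lborel) = indicator {0..\<rho>} r *
      ((r / 2) * (LINT z:cball 0 1|lborel. (1 - z \<bullet> z) * laplacian u (x + r *\<^sub>R z)))" for r
  proof (cases "r \<in> {0..\<rho>}")
    case True
    then have "cball x r \<subseteq> S" using S by auto
    with True have "(LINT z:cball 0 1|lborel. P z r)
        = (r / 2) * (LINT z:cball 0 1|lborel. (1 - z \<bullet> z) * laplacian u (x + r *\<^sub>R z))"
      unfolding P_def by (intro integral_radial_derivative[OF C2]) auto
    with True show ?thesis
      by (simp add: Q_def set_lebesgue_integral_def indicator_times)
  qed (simp add: Q_def indicator_times)
  have lap_bound: "ennreal \<bar>LINT z:cball 0 1|lborel. (1 - z \<bullet> z) * laplacian u (x + r *\<^sub>R z)\<bar>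
      \<le> (\<integral>\<^sup>+z\<in>cball 0 1. ennreal \<bar>laplacian u (x + r *\<^sub>R z)\<bar> \<partial>lborel)" if r: "0 \<le> r" "r \<le> \<rho>" for r
  proof -
    have "continuous_on (cball 0 1) (\<lambda>z. laplacian u (x + r *\<^sub>R z))"
      unfolding laplacian_def
      by (intro continuous_intros continuous_on_compose2[OF Ck_on_1D(2)[OF Ck_on_2D(2)[OF C2]]])
        (use r in \<open>auto intro!: memS\<close>)
    then have "set_integrable lborel (cball 0 1) (\<lambda>z. (1 - z \<bullet> z) * laplacian u (x + r *\<^sub>R z))"
      by (intro set_integrable_cball continuous_intros)
    then have "integrable lborel (\<lambda>z. indicator (cball 0 1) z *\<^sub>R ((1 - z \<bullet> z) * laplacian u (x + r *\<^sub>R z)))"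
      unfolding set_integrable_def .
    from integral_norm_bound_ennreal[OF this]
    have "ennreal \<bar>LINT z:cball 0 1|lborel. (1 - z \<bullet> z) * laplacian u (x + r *\<^sub>R z)\<bar>
        \<le> (\<integral>\<^sup>+z. ennreal \<bar>indicator (cball 0 1) z * ((1 - z \<bullet> z) * laplacian u (x + r *\<^sub>R z))\<bar> \<partial>lborel)"
      unfolding set_lebesgue_integral_def by simp
    also have "\<dots> \<le> (\<integral>\<^sup>+z\<in>cball 0 1. ennreal \<bar>laplacian u (x + r *\<^sub>R z)\<bar> \<partial>lborel)"
    proof (rule nn_integral_mono)
      fix z :: 'a
      have "\<bar>1 - z \<bullet> z\<bar> * \<bar>laplacian u (x + r *\<^sub>R z)\<bar> \<le> 1 * \<bar>laplacian u (x + r *\<^sub>R z)\<bar>"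
        if "norm z \<le> 1"
        using power_le_one[of "norm z" 2] that by (intro mult_right_mono) (auto simp: power2_norm_eq_inner)
      then show "ennreal \<bar>indicator (cball 0 1) z * ((1 - z \<bullet> z) * laplacian u (x + r *\<^sub>R z))\<bar>
          \<le> ennreal \<bar>laplacian u (x + r *\<^sub>R z)\<bar> * indicator (cball 0 1) z"
        by (auto simp: indicator_def abs_mult intro!: ennreal_leI)
    qed
    finally show ?thesis .
  qed
  have "(LINT z:cball 0 1|lborel. u (x + \<rho> *\<^sub>R z)) - measure lborel (cball (0::'a) 1) * u x
      = (LINT z:cball 0 1|lborel. u (x + \<rho> *\<^sub>R z)) - (LINT z:cball (0::'a) 1|lborel. u x)"
    by (simp add: set_lebesgue_integral_def)
  also have "\<dots> = (LINT z:cball 0 1|lborel. u (x + \<rho> *\<^sub>R z) - u x)"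
  proof (rule set_integral_diff(2)[symmetric])
    show "set_integrable lborel (cball 0 1) (\<lambda>z. u (x + \<rho> *\<^sub>R z))"
      by (intro set_integrable_cball continuous_on_compose2[OF u_cont] continuous_intros)
        (use \<rho> in \<open>auto intro!: memS\<close>)
    show "set_integrable lborel (cball (0::'a) 1) (\<lambda>z. u x)"
      by (intro set_integrable_cball continuous_intros)
  qed
  also have "\<dots> = (\<integral>z. (\<integral>r. Q z r \<partial>lborel) \<partial>lborel)"
    by (simp add: Q_z set_lebesgue_integral_def)
  also have "\<dots> = (\<integral>r. (\<integral>z. Q z r \<partial>lborel) \<partial>lborel)"
    using lborel_pair.Fubini_integral[OF Q_int] by simp
  also have "ennreal \<bar>\<dots>\<bar> \<le> (\<integral>\<^sup>+r. ennreal \<bar>\<integral>z. Q z r \<partial>lborel\<bar> \<partial>lborel)"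
    using integral_norm_bound_ennreal[OF lborel_pair.integrable_snd[OF Q_int]] by simp
  also have "\<dots> \<le> (\<integral>\<^sup>+r\<in>{0<..\<rho>}. ennreal (r / 2) *
          (\<integral>\<^sup>+z\<in>cball 0 1. ennreal \<bar>laplacian u (x + r *\<^sub>R z)\<bar> \<partial>lborel) \<partial>lborel)"
  proof (rule nn_integral_mono)
    fix r :: real
    show "ennreal \<bar>\<integral>z. Q z r \<partial>lborel\<bar> \<le> ennreal (r / 2) *
          (\<integral>\<^sup>+z\<in>cball 0 1. ennreal \<bar>laplacian u (x + r *\<^sub>R z)\<bar> \<partial>lborel) * indicator {0<..\<rho>} r"
    proof (cases "0 < r \<and> r \<le> \<rho>")
      case True
      then have "ennreal \<bar>\<integral>z. Q z r \<partial>lborel\<bar> = ennreal (r / 2) *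
          ennreal \<bar>LINT z:cball 0 1|lborel. (1 - z \<bullet> z) * laplacian u (x + r *\<^sub>R z)\<bar>"
        by (simp add: Q_r abs_mult flip: ennreal_mult')
      with True show ?thesis
        using lap_bound[of r] by (auto intro: mult_left_mono)
    next
      case False
      then have "(\<integral>z. Q z r \<partial>lborel) = 0"
        by (auto simp: Q_r indicator_def)
      then show ?thesis by simp
    qed
  qed
  finally show ?thesis .
qed

lemma nn_integral_cball_rescale:
  fixes g :: "'a::euclidean_space \<Rightarrow> ennreal"
  assumes [measurable]: "g \<in> borel_measurable borel" and r: "0 < r"
  shows "(\<integral>\<^sup>+y\<in>cball x r. g y \<partial>lborel)
    = ennreal (r ^ DIM('a)) * (\<integral>\<^sup>+z\<in>cball 0 1. g (x + r *\<^sub>R z) \<partial>lborel)"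
proof -
  have [measurable]: "cball c s \<in> sets borel" for c :: 'a and s
    by simp
  have "(\<integral>\<^sup>+y\<in>cball x r. g y \<partial>lborel)
      = (\<integral>\<^sup>+y\<in>cball x r. g y \<partial>density (distr lborel borel (\<lambda>z. x + r *\<^sub>R z)) (\<lambda>_. \<bar>r\<bar> ^ DIM('a)))"
    using r by (subst lborel_affine[of r x]) auto
  also have "\<dots> = (\<integral>\<^sup>+z. ennreal (r ^ DIM('a)) * (g (x + r *\<^sub>R z) * indicator (cball x r) (x + r *\<^sub>R z)) \<partial>lborel)"
  proof -
    have [measurable]: "(\<lambda>y. g y * indicator (cball x r) y) \<in> borel_measurable borel"
      by measurable
    show ?thesis
      using r by (subst nn_integral_density, simp, simp) (subst nn_integral_distr, simp_all)
  qed
  also have "\<dots> = (\<integral>\<^sup>+z. ennreal (r ^ DIM('a)) * (g (x + r *\<^sub>R z) * indicator (cball 0 1) z) \<partial>lborel)"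
    using r by (intro nn_integral_cong) (auto simp: indicator_def dist_norm)
  also have "\<dots> = ennreal (r ^ DIM('a)) * (\<integral>\<^sup>+z\<in>cball 0 1. g (x + r *\<^sub>R z) \<partial>lborel)"
    by (rule nn_integral_cmult) measurable
  finally show ?thesis .
qed

lemma unit_disc_measure: "measure lborel (cball (0 :: real ^ 2) 1) = pi"
  "measure lborel (ball (0 :: real ^ 2) 1) = pi"
  by (simp_all add: content_cball content_ball unit_ball_vol_2)

text \<open>In dimension two the substitution \<open>y = x + r z\<close> contributes a factor \<open>1 / r\<^sup>2\<close>, which turns the
  weight \<open>r / 2\<close> into the logarithmic weight \<open>1 / (2 r)\<close>.\<close>

lemma disc_mean_deviation:
  fixes u f :: "real ^ 2 \<Rightarrow> real"
  assumes C2: "Ck_on 2 (ball 0 1) u" and f_cont: "continuous_on (ball 0 1) f"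
    and lap: "\<And>y. y \<in> ball 0 1 \<Longrightarrow> laplacian u y = f y"
    and sub: "cball x \<rho> \<subseteq> ball 0 1" and \<rho>: "0 \<le> \<rho>" "\<rho> \<le> 1"
  shows "ennreal \<bar>(LINT z:cball 0 1|lborel. u (x + \<rho> *\<^sub>R z)) - pi * u x\<bar>
    \<le> ennreal (1/4) * LlnL_norm (ball 0 1) f"
proof -
  define F where "F y = indicator (ball 0 1) y * f y" for y
  define R where "R = rearrangement (ball 0 1) f"
  have [measurable]: "F \<in> borel_measurable borel"
    unfolding F_def using borel_measurable_continuous_on_indicator[OF _ f_cont] by simp
  have R: "R = rearrangement UNIV F"
    unfolding R_def F_def by (rule rearrangement_extend_by_zero)
  have [measurable]: "R \<in> borel_measurable borel"
    unfolding R_def by simp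
  have disc: "ennreal (r / 2) * (\<integral>\<^sup>+z\<in>cball 0 1. ennreal \<bar>laplacian u (x + r *\<^sub>R z)\<bar> \<partial>lborel)
      \<le> ennreal (1 / (2 * r)) * (\<integral>\<^sup>+t\<in>{0<..<pi * r\<^sup>2}. R t \<partial>lborel)" if r: "0 < r" "r \<le> \<rho>" for r
  proof -
    have mem: "x + r *\<^sub>R z \<in> ball 0 1" if "norm z \<le> 1" for z
    proof -
      have "r * norm z \<le> \<rho> * 1"
        using that r by (intro mult_mono) auto
      then have "x + r *\<^sub>R z \<in> cball x \<rho>"
        using r by (simp add: dist_norm)
      then show ?thesis using sub by blast
    qed
    have "(\<integral>\<^sup>+z\<in>cball 0 1. ennreal \<bar>laplacian u (x + r *\<^sub>R z)\<bar> \<partial>lborel)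
        = (\<integral>\<^sup>+z\<in>cball 0 1. ennreal \<bar>F (x + r *\<^sub>R z)\<bar> \<partial>lborel)"
    proof (rule nn_integral_cong)
      fix z :: "real ^ 2"
      show "ennreal \<bar>laplacian u (x + r *\<^sub>R z)\<bar> * indicator (cball 0 1) z
          = ennreal \<bar>F (x + r *\<^sub>R z)\<bar> * indicator (cball 0 1) z"
        using lap[OF mem, of z] mem[of z] by (auto simp: F_def indicator_def)
    qed
    then have "ennreal (r / 2) * (\<integral>\<^sup>+z\<in>cball 0 1. ennreal \<bar>laplacian u (x + r *\<^sub>R z)\<bar> \<partial>lborel)
        = ennreal (1 / (2 * r) * r\<^sup>2) * (\<integral>\<^sup>+z\<in>cball 0 1. ennreal \<bar>F (x + r *\<^sub>R z)\<bar> \<partial>lborel)"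
      using r by (simp add: power2_eq_square)
    also have "\<dots> = ennreal (1 / (2 * r)) * (\<integral>\<^sup>+y\<in>cball x r. ennreal \<bar>F y\<bar> \<partial>lborel)"
    proof -
      have "ennreal (1 / (2 * r) * r\<^sup>2) = ennreal (1 / (2 * r)) * ennreal (r ^ DIM(real ^ 2))"
        using r by (subst ennreal_mult[symmetric]) auto
      then show ?thesis
        using nn_integral_cball_rescale[of "\<lambda>y. ennreal \<bar>F y\<bar>" r x] r by (simp only: mult.assoc) simp
    qed
    also have "\<dots> \<le> ennreal (1 / (2 * r)) * (\<integral>\<^sup>+t\<in>{0<..<pi * r\<^sup>2}. R t \<partial>lborel)"
      unfolding R using r
      by (intro mult_left_mono nn_integral_le_integral_rearrangement)
        (simp_all add: emeasure_cball unit_ball_vol_2)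
    finally show ?thesis .
  qed
  have "ennreal \<bar>(LINT z:cball 0 1|lborel. u (x + \<rho> *\<^sub>R z)) - pi * u x\<bar>
      \<le> (\<integral>\<^sup>+r\<in>{0<..\<rho>}. ennreal (r / 2) *
          (\<integral>\<^sup>+z\<in>cball 0 1. ennreal \<bar>laplacian u (x + r *\<^sub>R z)\<bar> \<partial>lborel) \<partial>lborel)"
    using mean_value_deviation[OF C2 sub \<rho>(1)] by (simp add: unit_disc_measure)
  also have "\<dots> \<le> (\<integral>\<^sup>+r\<in>{0<..1}. ennreal (1 / (2 * r)) * (\<integral>\<^sup>+t\<in>{0<..<pi * r\<^sup>2}. R t \<partial>lborel) \<partial>lborel)"
    using disc \<rho>(2) by (intro nn_integral_mono) (auto simp: indicator_def)
  also have "\<dots> \<le> ennreal (1/4) * (\<integral>\<^sup>+t\<in>{0<..}. R t * ennreal (ln (pi / t)) \<partial>lborel)"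
    by (rule nn_integral_log_weight) measurable
  also have "\<dots> = ennreal (1/4) * LlnL_norm (ball 0 1) f"
    by (simp add: LlnL_norm_def R_def unit_disc_measure)
  finally show ?thesis .
qed

section \<open>The Harnack chain\<close>

text \<open>Up to the common factor, \<open>r\<^sup>2\<close> times the average is the integral of \<open>u\<close> over the disc of radius
  \<open>r\<close>, and integrals of a nonnegative function grow with the domain.\<close>

lemma disc_averages_comparison:
  fixes u :: "real ^ 2 \<Rightarrow> real"
  assumes cont: "continuous_on (ball 0 1) u" and nonneg: "\<And>y. y \<in> ball 0 1 \<Longrightarrow> 0 \<le> u y"
    and sub: "cball x r \<subseteq> cball y s" "cball y s \<subseteq> ball 0 1" and pos: "0 < r" "0 < s"
  shows "r\<^sup>2 * (LINT z:cball 0 1|lborel. u (x + r *\<^sub>R z)) \<le> s\<^sup>2 * (LINT z:cball 0 1|lborel. u (y + s *\<^sub>R z))"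
proof -
  define U where "U y = indicator (ball 0 1) y * u y" for y
  have [measurable]: "U \<in> borel_measurable borel"
    unfolding U_def using borel_measurable_continuous_on_indicator[OF _ cont] by simp
  have eq: "ennreal (r\<^sup>2 * (LINT z:cball 0 1|lborel. u (x + r *\<^sub>R z))) = (\<integral>\<^sup>+y\<in>cball x r. ennreal (U y) \<partial>lborel)"
    if r: "0 < r" and "cball x r \<subseteq> ball 0 1" for x r
  proof -
    have mem: "x + r *\<^sub>R z \<in> ball 0 1" if "norm z \<le> 1" for z
    proof -
      have "x + r *\<^sub>R z \<in> cball x r"
        using that r by (simp add: dist_norm mult_left_le)
      then show ?thesis using \<open>cball x r \<subseteq> ball 0 1\<close> by blast
    qed
    have "set_integrable lborel (cball 0 1) (\<lambda>z. u (x + r *\<^sub>R z))"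
      by (intro set_integrable_cball continuous_on_compose2[OF cont] continuous_intros image_subsetI mem) simp
    then have "ennreal (LINT z:cball 0 1|lborel. u (x + r *\<^sub>R z))
        = (\<integral>\<^sup>+z. ennreal (indicator (cball 0 1) z *\<^sub>R u (x + r *\<^sub>R z)) \<partial>lborel)"
      unfolding set_lebesgue_integral_def set_integrable_def
      by (intro nn_integral_eq_integral[symmetric] AE_I2) (auto simp: indicator_def intro!: nonneg mem)
    also have "\<dots> = (\<integral>\<^sup>+z\<in>cball 0 1. ennreal (U (x + r *\<^sub>R z)) \<partial>lborel)"
      using mem by (intro nn_integral_cong) (auto simp: indicator_def U_def)
    finally have "ennreal (r\<^sup>2) * ennreal (LINT z:cball 0 1|lborel. u (x + r *\<^sub>R z))
        = (\<integral>\<^sup>+y\<in>cball x r. ennreal (U y) \<partial>lborel)"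
      using r by (subst nn_integral_cball_rescale) simp_all
    then show ?thesis
      by (simp add: ennreal_mult')
  qed
  have "ennreal (r\<^sup>2 * (LINT z:cball 0 1|lborel. u (x + r *\<^sub>R z))) \<le> ennreal (s\<^sup>2 * (LINT z:cball 0 1|lborel. u (y + s *\<^sub>R z)))"
    using sub pos by (subst (1 2) eq) (auto intro!: nn_set_integral_set_mono)
  moreover have "0 \<le> s\<^sup>2 * (LINT z:cball 0 1|lborel. u (y + s *\<^sub>R z))"
    unfolding set_lebesgue_integral_def
  proof (intro mult_nonneg_nonneg integral_nonneg_AE AE_I2)
    fix z :: "real ^ 2"
    have "y + s *\<^sub>R z \<in> cball y s" if "norm z \<le> 1"
      using that pos by (simp add: dist_norm mult_left_le)
    then show "0 \<le> indicator (cball 0 1) z *\<^sub>R u (y + s *\<^sub>R z)"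
      using sub(2) by (auto simp: indicator_def intro!: nonneg)
  qed simp
  ultimately show ?thesis by simp
qed

text \<open>The radii \<open>1/5\<close> and \<open>2/5\<close> are chosen so that the disc around \<open>x\<close> lies in the one around \<open>y\<close>,
  while both stay in the unit disc. The ratio of their areas is the factor \<open>4\<close>; the two deviations
  cost \<open>n/4 + 4 n/4 = 5 n/4\<close>, which is at most \<open>\<pi> n\<close>.\<close>

lemma harnack_nearby_points:
  fixes u :: "real ^ 2 \<Rightarrow> real"
  assumes cont: "continuous_on (ball 0 1) u" and nonneg: "\<And>y. y \<in> ball 0 1 \<Longrightarrow> 0 \<le> u y"
    and dev: "\<And>x \<rho>. cball x \<rho> \<subseteq> ball 0 1 \<Longrightarrow> 0 \<le> \<rho> \<Longrightarrow> \<rho> \<le> 1 \<Longrightarrow>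
      \<bar>(LINT z:cball 0 1|lborel. u (x + \<rho> *\<^sub>R z)) - pi * u x\<bar> \<le> n / 4"
    and x: "x \<in> ball 0 (1/2)" and y: "y \<in> ball 0 (1/2)" and near: "dist x y \<le> 1/5"
  shows "u x \<le> 4 * u y + n"
proof -
  have sub: "cball w \<rho> \<subseteq> ball 0 1" if "w \<in> ball 0 (1/2)" "\<rho> \<le> 1/2" for w :: "real ^ 2" and \<rho>
  proof
    fix z assume "z \<in> cball w \<rho>"
    then show "z \<in> ball 0 1"
      using that dist_triangle[of 0 z w] by (simp add: mem_ball mem_cball del: dist_0_norm)
  qed
  have "cball x (1/5) \<subseteq> cball y (2/5)"
  proof -
    have "dist y z \<le> 2/5" if "dist x z \<le> 1/5" for z
      using that near dist_triangle[of y z x] by (simp add: dist_commute)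
    then show ?thesis by auto
  qed
  then have "(1/5)\<^sup>2 * (LINT z:cball 0 1|lborel. u (x + (1/5) *\<^sub>R z))
      \<le> (2/5)\<^sup>2 * (LINT z:cball 0 1|lborel. u (y + (2/5) *\<^sub>R z))"
    using y by (intro disc_averages_comparison cont nonneg sub) auto
  then have "(LINT z:cball 0 1|lborel. u (x + (1/5) *\<^sub>R z))
      \<le> 4 * (LINT z:cball 0 1|lborel. u (y + (2/5) *\<^sub>R z))"
    by (simp add: power2_eq_square)
  moreover have "pi * u x - n / 4 \<le> (LINT z:cball 0 1|lborel. u (x + (1/5) *\<^sub>R z))"
    using dev[OF sub[OF x, of "1/5"]] unfolding abs_le_iff by simp
  moreover have "(LINT z:cball 0 1|lborel. u (y + (2/5) *\<^sub>R z)) \<le> pi * u y + n / 4"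
    using dev[OF sub[OF y, of "2/5"]] unfolding abs_le_iff by simp
  ultimately have "pi * u x \<le> 4 * (pi * u y) + 5 * n / 4"
    by linarith
  also have "5 * n / 4 \<le> pi * n"
  proof -
    have "0 \<le> n" using order_trans[OF abs_ge_zero dev[OF sub[OF x, of 0]]] by simp
    then show ?thesis using pi_gt3 mult_right_mono[of "5/4" pi n] by simp
  qed
  finally have "pi * u x \<le> pi * (4 * u y + n)" by (simp add: algebra_simps)
  then show ?thesis by simp
qed

text \<open>Points of the half disc have distance at most \<open>1\<close>, so five steps of length at most \<open>1/5\<close> lead
  from \<open>y\<close> to \<open>x\<close>. The constant is \<open>4\<^sup>5 = 1024\<close>; the error terms add up to
  \<open>(1 + 4 + 16 + 64 + 256) n\<close>.\<close>

lemma harnack_half_disc: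
  fixes u :: "real ^ 2 \<Rightarrow> real"
  assumes cont: "continuous_on (ball 0 1) u" and nonneg: "\<And>y. y \<in> ball 0 1 \<Longrightarrow> 0 \<le> u y"
    and dev: "\<And>x \<rho>. cball x \<rho> \<subseteq> ball 0 1 \<Longrightarrow> 0 \<le> \<rho> \<Longrightarrow> \<rho> \<le> 1 \<Longrightarrow>
      \<bar>(LINT z:cball 0 1|lborel. u (x + \<rho> *\<^sub>R z)) - pi * u x\<bar> \<le> n / 4"
    and x: "x \<in> ball 0 (1/2)" and y: "y \<in> ball 0 (1/2)"
  shows "u x \<le> 1024 * (u y + n)"
proof -
  define p where "p t = (1 - t) *\<^sub>R y + t *\<^sub>R x" for t
  have p: "p t \<in> ball 0 (1/2)" if "0 \<le> t" "t \<le> 1" for t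
    unfolding p_def using that by (intro convexD_alt[OF convex_ball y x])
  have "dist x y \<le> 1"
    using x y dist_triangle2[of x y 0] by (simp add: dist_commute)
  have near: "dist (p t) (p s) \<le> 1/5" if "t - s = 1/5" for t s
  proof -
    have "p t - p s = (t - s) *\<^sub>R (x - y)"
      by (simp add: p_def algebra_simps)
    then show ?thesis
      using that \<open>dist x y \<le> 1\<close> by (simp add: dist_norm)
  qed
  have step: "u (p t) \<le> 4 * u (p s) + n" if "t - s = 1/5" "0 \<le> s" "t \<le> 1" for t s
    using that by (intro harnack_nearby_points[OF cont nonneg dev] p near) auto
  have "0 \<le> n" using order_trans[OF abs_ge_zero dev[of 0 0]] by simp
  moreover have "p 0 = y" "p 1 = x" by (simp_all add: p_def)
  ultimately show ?thesis
    using step[of "1/5" 0] step[of "2/5" "1/5"] step[of "3/5" "2/5"] step[of "4/5" "3/5"] step[of 1 "4/5"]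
    by simp
qed

theorem corollary1p4:
  shows "\<exists>C::real. C > 0 \<and>
    (\<forall>(u :: real ^ 2 \<Rightarrow> real) (f :: real ^ 2 \<Rightarrow> real).
       smooth_on (ball 0 1) u \<longrightarrow>
       smooth_on (ball 0 1) f \<longrightarrow>
       f \<in> LlnL (ball 0 1) \<longrightarrow>
       (\<forall>x\<in>ball 0 1. u x \<ge> 0) \<longrightarrow>
       (\<forall>x\<in>ball 0 1. laplacian u x = f x) \<longrightarrow>
       (SUP x\<in>ball 0 (1/2). ennreal (u x))
         \<le> ennreal C * ((INF y\<in>ball 0 (1/2). ennreal (u y)) + LlnL_norm (ball 0 1) f))"
proof (intro exI[of _ 1024] conjI allI impI)
  fix u f :: "real ^ 2 \<Rightarrow> real"
  assume u: "smooth_on (ball 0 1) u" and f: "smooth_on (ball 0 1) f"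
    and nonneg: "\<forall>x\<in>ball 0 1. u x \<ge> 0" and lap: "\<forall>x\<in>ball 0 1. laplacian u x = f x"
  have C2: "Ck_on 2 (ball 0 1) u" and u_cont: "continuous_on (ball 0 1) u"
    and f_cont: "continuous_on (ball 0 1) f"
    using u f Ck_on.simps(1) unfolding smooth_on_def by blast+
  let ?N = "LlnL_norm (ball 0 1) f" and ?I = "INF y\<in>ball 0 (1/2). ennreal (u y)"
  show "(SUP x\<in>ball 0 (1/2). ennreal (u x)) \<le> ennreal 1024 * (?I + ?N)"
  proof (cases ?N)
    case (real n)
    have dev: "\<bar>(LINT z:cball 0 1|lborel. u (x + \<rho> *\<^sub>R z)) - pi * u x\<bar> \<le> n / 4"
      if "cball x \<rho> \<subseteq> ball 0 1" "0 \<le> \<rho>" "\<rho> \<le> 1" for x \<rho>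
    proof -
      have "ennreal \<bar>(LINT z:cball 0 1|lborel. u (x + \<rho> *\<^sub>R z)) - pi * u x\<bar> \<le> ennreal (1/4) * ?N"
        using lap by (intro disc_mean_deviation C2 f_cont that) auto
      also have "\<dots> = ennreal (n / 4)"
        using real ennreal_mult'[of "1/4" n] by simp
      finally show ?thesis
        using real by simp
    qed
    show ?thesis
    proof (rule SUP_least)
      fix x :: "real ^ 2" assume x: "x \<in> ball 0 (1/2)"
      \<comment> \<open>Solving the inequality for \<open>u y\<close> lets the infimum be taken without subtracting in
        \<open>[0, \<infinity>]\<close>; where \<open>u x / 1024 - n\<close> is negative, \<open>ennreal\<close> turns it into \<open>0\<close>.\<close>
      have "ennreal (u x / 1024 - n) \<le> ?I"
      proof (rule INF_greatest)
        fix y :: "real ^ 2" assume "y \<in> ball 0 (1/2)"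
        then have "u x \<le> 1024 * (u y + n)"
          using nonneg by (intro harnack_half_disc[OF u_cont _ dev x]) auto
        then show "ennreal (u x / 1024 - n) \<le> ennreal (u y)"
          by (intro ennreal_leI) simp
      qed
      have "ennreal (u x) \<le> ennreal (1024 * (max 0 (u x / 1024 - n) + n))"
      proof (rule ennreal_leI)
        have "u x = 1024 * ((u x / 1024 - n) + n)" by simp
        also have "\<dots> \<le> 1024 * (max 0 (u x / 1024 - n) + n)"
          by (intro mult_left_mono add_right_mono) simp_all
        finally show "u x \<le> 1024 * (max 0 (u x / 1024 - n) + n)" .
      qed
      also have "\<dots> = ennreal 1024 * (ennreal (u x / 1024 - n) + ennreal n)"
        using real by (simp add: ennreal_mult ennreal_plus max_def ennreal_neg)
      also have "\<dots> \<le> ennreal 1024 * (?I + ?N)"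
        using \<open>ennreal (u x / 1024 - n) \<le> ?I\<close> real by (intro mult_left_mono add_mono) auto
      finally show "ennreal (u x) \<le> ennreal 1024 * (?I + ?N)" .
    qed
  next
    case top
    then show ?thesis by (simp add: ennreal_mult_top)
  qed
qed simp

end
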